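(* Let $\mathcal E\equiv\{\rho_x;p(x)\}$ be an ensemble of density operators indexed by a real parameter $X$ with prior probability density $p(x)$, and let $X_{\rm est}$ be an estimate of $X$ made by a measurement on the ensemble, described by a POVM $\{M_{x_{\rm est}}\}$ on the real line. Then for all $\alpha\ge\frac12$ the classical Rényi mutual information satisfies $$I_\alpha(X_{\rm est}:X)\ \ge\ \inf_q D_\alpha(p_{\rm err}\,\|\,q\ast p_-),$$ where the infimum is over probability densities $q$ on the real line, $p_{\rm err}(y)$ is the probability density of the error $X_{\rm est}-X$, $(f\ast g)(y)=\int dx\,f(x)g(y-x)$ denotes convolution, and $p_-(x):=p(-x)$.
   Context: The joint density of $X_{\rm est}$ and $X$ is $p_{X_{\rm est}X}(x_{\rm est},x)=p(x)\,\mathrm{tr}[\rho_xM_{x_{\rm est}}]$, and the error density is $p_{\rm err}(y)=\int dx\,p_{X_{\rm est}X}(x+y,x)$. Classical Rényi relative entropy: $D_\alpha(p\|q)=\frac1{\alpha-1}\log\int dz\,p(z)^\alpha q(z)^{1-\alpha}$, with $\alpha=1$ (the usual relative entropy) by the limit; it is infinite if $\alpha\ge1$ and the support of $p$ is not contained in that of $q$. Classical Rényi mutual information: $I_\alpha(A:X)=\inf_{q_A}D_\alpha(p_{AX}\|q_Ap_X)$, where $p_{AX}$ is the joint density of $A$ and $X$, $p_X$ is the marginal density of $X$, and the infimum is over all probability densities $q_A$ for $A$. *)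

theory Defs
  imports "HOL-Probability.Probability"
begin

section \<open>Complex Hilbert spaces\<close>

text \<open>The inner product is antilinear in the first argument and linear in the second.
  No restriction is made on the dimension.\<close>

class chilbert_space = banach +
  fixes scaleC :: "complex \<Rightarrow> 'a \<Rightarrow> 'a" (infixr "*\<^sub>C" 75)
    and cinner :: "'a \<Rightarrow> 'a \<Rightarrow> complex"
  assumes scaleC_add_right: "c *\<^sub>C (x + y) = c *\<^sub>C x + c *\<^sub>C y"
    and scaleC_add_left: "(c + d) *\<^sub>C x = c *\<^sub>C x + d *\<^sub>C x"
    and scaleC_scaleC: "c *\<^sub>C (d *\<^sub>C x) = (c * d) *\<^sub>C x"
    and scaleR_scaleC: "r *\<^sub>R x = complex_of_real r *\<^sub>C x"
    and cinner_commute: "cinner x y = cnj (cinner y x)"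
    and cinner_add_right: "cinner x (y + z) = cinner x y + cinner x z"
    and cinner_scaleC_right: "cinner x (c *\<^sub>C y) = c * cinner x y"
    and cinner_self: "cinner x x = complex_of_real ((norm x)\<^sup>2)"

instantiation complex :: chilbert_space
begin

definition scaleC_complex :: "complex \<Rightarrow> complex \<Rightarrow> complex"
  where "scaleC_complex c x = c * x"

definition cinner_complex :: "complex \<Rightarrow> complex \<Rightarrow> complex"
  where "cinner_complex x y = cnj x * y"

instance
  by standard
    (simp_all add: scaleC_complex_def cinner_complex_def algebra_simps scaleR_conv_of_real
      complex_norm_square[symmetric] flip: of_real_power)

end

section \<open>Density operators and POVMs\<close>

definition bounded_clinear :: "('h::chilbert_space \<Rightarrow> 'h) \<Rightarrow> bool" where
  "bounded_clinear A \<longleftrightarrow> bounded_linear A \<and> (\<forall>c v. A (c *\<^sub>C v) = c *\<^sub>C A v)"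

definition positive_operator :: "('h::chilbert_space \<Rightarrow> 'h) \<Rightarrow> bool" where
  "positive_operator A \<longleftrightarrow> bounded_clinear A \<and> (\<forall>v. cinner v (A v) \<in> \<real>\<^sub>\<ge>\<^sub>0)"

text \<open>An orthonormal basis is a maximal orthonormal set.\<close>

definition orthonormal_basis :: "'h::chilbert_space set \<Rightarrow> bool" where
  "orthonormal_basis B \<longleftrightarrow>
     (\<forall>u\<in>B. \<forall>v\<in>B. cinner u v = (if u = v then 1 else 0)) \<and>
     (\<forall>x. (\<forall>u\<in>B. cinner u x = 0) \<longrightarrow> x = 0)"

text \<open>The basis is arbitrary: the trace of a trace-class operator does not depend on it.\<close>

definition op_trace :: "('h::chilbert_space \<Rightarrow> 'h) \<Rightarrow> complex" where
  "op_trace A = (\<Sum>\<^sub>\<infinity>e\<in>(SOME B. orthonormal_basis B). cinner e (A e))"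

text \<open>A positive operator is trace-class iff its diagonal is summable in some orthonormal
  basis. Since a non-summable infinite sum is \<open>0\<close> by convention, \<open>op_trace A = 1\<close> contains the
  trace-class condition.\<close>

definition density_operator :: "('h::chilbert_space \<Rightarrow> 'h) \<Rightarrow> bool" where
  "density_operator A \<longleftrightarrow> positive_operator A \<and> op_trace A = 1"

text \<open>A POVM on the Borel sets of the real line, \<open>\<sigma>\<close>-additive in the weak operator topology.\<close>

definition povm :: "(real set \<Rightarrow> 'h::chilbert_space \<Rightarrow> 'h) \<Rightarrow> bool" where
  "povm M \<longleftrightarrow>
     (\<forall>A\<in>sets borel. positive_operator (M A)) \<and>
     M UNIV = id \<and>
     (\<forall>F :: nat \<Rightarrow> real set. range F \<subseteq> sets borel \<longrightarrow> disjoint_family F \<longrightarrow>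
        (\<forall>u v. (\<lambda>n. cinner u (M (F n) v)) sums cinner u (M (\<Union>n. F n) v)))"

text \<open>\<open>t a x\<close> is the number that is written \<open>tr[\<rho>\<^sub>x M\<^sub>a]\<close> for an operator-valued density \<open>M\<^sub>a\<close>
  of the POVM with respect to \<open>da\<close>: it is the probability density, at the outcome \<open>a\<close>, of the
  outcome distribution \<open>A \<mapsto> tr[\<rho>\<^sub>x M(A)]\<close>. Working with this density rather
  than with operators \<open>M\<^sub>a\<close> also covers unnormalisable POVM elements such as
  \<open>M\<^sub>a = |a\<rangle>\<langle>a|\<close>, which are not operators on the Hilbert space.\<close>

definition outcome_density ::
  "(real \<Rightarrow> 'h::chilbert_space \<Rightarrow> 'h) \<Rightarrow> (real set \<Rightarrow> 'h \<Rightarrow> 'h) \<Rightarrow> (real \<Rightarrow> real \<Rightarrow> real) \<Rightarrow> bool"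
  where
  "outcome_density \<rho> M t \<longleftrightarrow>
     (\<lambda>(a, x). t a x) \<in> borel_measurable borel \<and>
     (\<forall>a x. 0 \<le> t a x) \<and>
     (\<forall>x. \<forall>A\<in>sets borel.
        (\<integral>\<^sup>+a\<in>A. ennreal (t a x) \<partial>lborel) = ennreal (Re (op_trace (\<rho> x \<circ> M A))))"

section \<open>Probability densities\<close>

definition prob_density :: "('z::euclidean_space \<Rightarrow> real) \<Rightarrow> bool" where
  "prob_density f \<longleftrightarrow>
     f \<in> borel_measurable borel \<and> (\<forall>z. 0 \<le> f z) \<and> (\<integral>\<^sup>+z. ennreal (f z) \<partial>lborel) = 1"

text \<open>Joint densities take the pair (estimate, parameter), in this order.\<close>

definition joint_density :: "(real \<Rightarrow> real) \<Rightarrow> (real \<Rightarrow> real \<Rightarrow> real) \<Rightarrow> real \<times> real \<Rightarrow> real" where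
  "joint_density p t = (\<lambda>(a, x). p x * t a x)"

definition error_density :: "(real \<times> real \<Rightarrow> real) \<Rightarrow> real \<Rightarrow> real" where
  "error_density f y = (\<integral>x. f (x + y, x) \<partial>lborel)"

definition snd_marginal :: "(real \<times> real \<Rightarrow> real) \<Rightarrow> real \<Rightarrow> real" where
  "snd_marginal f x = (\<integral>a. f (a, x) \<partial>lborel)"

definition conv :: "(real \<Rightarrow> real) \<Rightarrow> (real \<Rightarrow> real) \<Rightarrow> real \<Rightarrow> real" where
  "conv f g y = (\<integral>x. f x * g (y - x) \<partial>lborel)"

section \<open>Renyi relative entropy and mutual information\<close>

definition ln_ext :: "ennreal \<Rightarrow> ereal" where
  "ln_ext u = (if u = 0 then -\<infinity> else if u = \<top> then \<infinity> else ereal (ln (enn2real u)))"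

text \<open>The usual relative entropy, with values in the extended reals (the library's
  \<open>KL_divergence\<close> is real-valued). The subtrahend is at most \<open>1\<close> for probability densities, since
  \<open>p ln (p / q) \<ge> p - q\<close>. The convention \<open>x / 0 = 0\<close> is harmless: the set where \<open>q = 0 < p\<close> is
  null in the second case.\<close>

definition relative_entropy :: "('z::euclidean_space \<Rightarrow> real) \<Rightarrow> ('z \<Rightarrow> real) \<Rightarrow> ereal" where
  "relative_entropy p q =
     (if \<not> (AE z in lborel. q z = 0 \<longrightarrow> p z = 0) then \<infinity>
      else enn2ereal (\<integral>\<^sup>+z. ennreal (p z * ln (p z / q z)) \<partial>lborel)
         - enn2ereal (\<integral>\<^sup>+z. ennreal (- (p z * ln (p z / q z))) \<partial>lborel))"

text \<open>As densities are determined only almost everywhere, inclusion of supports is read almost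
  everywhere. For \<open>\<alpha> < 1\<close> and \<open>p\<close>, \<open>q\<close> with disjoint supports the value is
  \<open>(1 / (\<alpha> - 1)) * (-\<infinity>) = \<infinity>\<close>. As \<open>0 powr s = 0\<close> for every \<open>s\<close>, points where \<open>p\<close> vanishes do not
  contribute.\<close>

definition renyi_divergence ::
  "real \<Rightarrow> ('z::euclidean_space \<Rightarrow> real) \<Rightarrow> ('z \<Rightarrow> real) \<Rightarrow> ereal" where
  "renyi_divergence \<alpha> p q =
     (if \<alpha> = 1 then relative_entropy p q
      else if \<alpha> > 1 \<and> \<not> (AE z in lborel. q z = 0 \<longrightarrow> p z = 0) then \<infinity>
      else ereal (1 / (\<alpha> - 1)) *
             ln_ext (\<integral>\<^sup>+z. ennreal (p z powr \<alpha> * q z powr (1 - \<alpha>)) \<partial>lborel))"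

definition renyi_mutual_information :: "real \<Rightarrow> (real \<times> real \<Rightarrow> real) \<Rightarrow> ereal" where
  "renyi_mutual_information \<alpha> f =
     (INF q\<in>{q. prob_density q}. renyi_divergence \<alpha> f (\<lambda>(a, x). q a * snd_marginal f x))"

end

theory Submission
  imports Defs
begin

text \<open>
  The map taking an estimate and a parameter to their difference is a classical channel. It sends
  the joint density to the error density and the product of \<open>q\<close> and \<open>p\<close> to \<open>q \<ast> p\<^sub>-\<close>, so the
  bound is the data processing inequality, and it holds for each \<open>q\<close> separately. In the
  coordinates \<open>(y, x)\<close> with \<open>y\<close> the error, the channel integrates out \<open>x\<close>. For fixed \<open>y\<close>, Jensen's
  inequality is obtained by integrating the tangent line inequality at the ratio of the two
  marginals at \<open>y\<close>.
\<close>

section \<open>Tangent line inequalities\<close>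

text \<open>For \<open>0 < \<alpha> < 1\<close> the left side is concave and homogeneous of degree 1
  in \<open>(u, v)\<close>, and the right side is its tangent plane along the ray
  \<open>u = c * v\<close>. It is Young's inequality for \<open>u\<close> and \<open>v\<close>
  rescaled by powers of \<open>c\<close> that cancel in the weighted product.\<close>

lemma powr_tangent_upper:
  fixes u v c \<alpha> :: real
  assumes "0 < \<alpha>" "\<alpha> < 1" "0 \<le> u" "0 \<le> v" "0 < c"
  shows "u powr \<alpha> * v powr (1 - \<alpha>) \<le> \<alpha> * c powr (\<alpha> - 1) * u + (1 - \<alpha>) * c powr \<alpha> * v"
proof (cases "u = 0 \<or> v = 0")
  case False
  then have uv: "0 < u" "0 < v" using assms by auto
  have "(c powr (\<alpha> - 1) * u) powr \<alpha> * (c powr \<alpha> * v) powr (1 - \<alpha>) =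
      c powr ((\<alpha> - 1) * \<alpha> + \<alpha> * (1 - \<alpha>)) * (u powr \<alpha> * v powr (1 - \<alpha>))"
    using uv assms by (simp add: powr_mult powr_powr powr_add)
  also have "(\<alpha> - 1) * \<alpha> + \<alpha> * (1 - \<alpha>) = 0"
    by (simp add: algebra_simps)
  finally have "u powr \<alpha> * v powr (1 - \<alpha>) =
      (c powr (\<alpha> - 1) * u) powr \<alpha> * (c powr \<alpha> * v) powr (1 - \<alpha>)"
    using assms by simp
  also have "\<dots> \<le> \<alpha> * (c powr (\<alpha> - 1) * u) + (1 - \<alpha>) * (c powr \<alpha> * v)"
    using uv assms by (intro Youngs_inequality_0) auto
  finally show ?thesis by (simp add: mult.assoc)
qed (use assms in auto)

text \<open>For \<open>\<alpha> > 1\<close> the same function is convex, so the tangent plane along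
  \<open>u = c * v\<close> lies below it. Its negative term is moved to the right, so that every
  term can be integrated in \<open>ennreal\<close>. The proof is Young's inequality with weight
  \<open>1 / \<alpha>\<close> for \<open>?X\<close> and \<open>?Y\<close>, whose weighted geometric
  mean is \<open>c powr (\<alpha> - 1) * u\<close>. At \<open>v = 0 < u\<close> the convention
  \<open>0 powr s = 0\<close> would make the right side vanish, which the last assumption
  excludes.\<close>

lemma powr_tangent_lower:
  fixes u v c \<alpha> :: real
  assumes "1 < \<alpha>" "0 \<le> u" "0 \<le> v" "0 < c" "v = 0 \<longrightarrow> u = 0"
  shows "\<alpha> * c powr (\<alpha> - 1) * u \<le> u powr \<alpha> * v powr (1 - \<alpha>) + (\<alpha> - 1) * c powr \<alpha> * v"
proof (cases "u = 0")
  case False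
  then have uv: "0 < u" "0 < v" using assms by (auto simp: less_le)
  let ?X = "u powr \<alpha> * v powr (1 - \<alpha>)" and ?Y = "c powr \<alpha> * v"
  have "?X powr (1 / \<alpha>) * ?Y powr (1 - 1 / \<alpha>) =
      u powr (\<alpha> * (1 / \<alpha>)) * v powr ((1 - \<alpha>) * (1 / \<alpha>) + (1 - 1 / \<alpha>)) *
      c powr (\<alpha> * (1 - 1 / \<alpha>))"
    using uv assms by (simp add: powr_mult powr_powr powr_add)
  also have "\<alpha> * (1 / \<alpha>) = 1" using assms by simp
  also have "(1 - \<alpha>) * (1 / \<alpha>) + (1 - 1 / \<alpha>) = 0"
    using assms by (simp add: field_simps)
  also have "\<alpha> * (1 - 1 / \<alpha>) = \<alpha> - 1" using assms by (simp add: field_simps)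
  finally have "c powr (\<alpha> - 1) * u = ?X powr (1 / \<alpha>) * ?Y powr (1 - 1 / \<alpha>)"
    using uv by simp
  also have "\<dots> \<le> (1 / \<alpha>) * ?X + (1 - 1 / \<alpha>) * ?Y"
    using uv assms by (intro Youngs_inequality_0) auto
  finally have "\<alpha> * (c powr (\<alpha> - 1) * u) \<le> \<alpha> * ((1 / \<alpha>) * ?X + (1 - 1 / \<alpha>) * ?Y)"
    using assms by (intro mult_left_mono) auto
  also have "\<dots> = ?X + (\<alpha> - 1) * ?Y" using assms by (simp add: field_simps)
  finally show ?thesis by (simp add: mult.assoc)
qed (use assms in auto)

text \<open>The tangent plane of the convex function \<open>u * ln (u / v)\<close> along
  \<open>u = c * v\<close>, obtained from \<open>ln s \<le> s - 1\<close> at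
  \<open>s = c * v / u\<close>.\<close>

lemma entropy_tangent:
  fixes u v c :: real
  assumes "0 \<le> u" "0 \<le> v" "0 < c" "v = 0 \<longrightarrow> u = 0"
  shows "u * ln c + u \<le> u * ln (u / v) + c * v"
proof (cases "u = 0")
  case False
  then have uv: "0 < u" "0 < v" using assms by (auto simp: less_le)
  have "ln (c * v / u) \<le> c * v / u - 1"
    using uv assms by (intro ln_le_minus_one) auto
  also have "ln (c * v / u) = ln c - ln (u / v)"
    using uv assms by (simp add: ln_div ln_mult)
  finally have "u * (ln c - ln (u / v)) \<le> u * (c * v / u - 1)"
    using uv by (intro mult_left_mono) auto
  then show ?thesis using uv by (simp add: algebra_simps)
qed (use assms in auto)

section \<open>Jensen inequalities for a fixed value of the error\<close>

lemma nn_integral_ennreal_eq_0: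
  fixes f :: "'a \<Rightarrow> real"
  assumes [measurable]: "f \<in> borel_measurable N"
    and "\<And>x. 0 \<le> f x" "(\<integral>\<^sup>+x. ennreal (f x) \<partial>N) = 0"
  shows "AE x in N. f x = 0"
proof -
  have "AE x in N. ennreal (f x) = 0"
    using assms(3) by (subst (asm) nn_integral_0_iff_AE) auto
  then show ?thesis
    by eventually_elim (use assms(2) in \<open>simp add: ennreal_eq_0_iff antisym\<close>)
qed

text \<open>Applied with \<open>f\<close>, \<open>g\<close> the slices at a fixed error and
  \<open>F\<close>, \<open>G\<close> the values of the two error densities there: inclusion of
  supports passes from the slices to the marginals. It also settles the degenerate cases of the
  inequalities below.\<close>

lemma absolutely_continuous_mass:
  fixes f g :: "'a \<Rightarrow> real"
  assumes [measurable]: "f \<in> borel_measurable N" "g \<in> borel_measurable N"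
    and nn: "\<And>x. 0 \<le> f x" "\<And>x. 0 \<le> g x" "0 \<le> F"
    and int: "(\<integral>\<^sup>+x. ennreal (f x) \<partial>N) = ennreal F" "(\<integral>\<^sup>+x. ennreal (g x) \<partial>N) = ennreal G"
    and ac: "AE x in N. g x = 0 \<longrightarrow> f x = 0"
    and "G = 0"
  shows "F = 0"
proof -
  have "AE x in N. g x = 0"
    using assms by (intro nn_integral_ennreal_eq_0) auto
  with ac have "AE x in N. ennreal (f x) = 0"
    by eventually_elim auto
  then have "(\<integral>\<^sup>+x. ennreal (f x) \<partial>N) = 0"
    by (subst nn_integral_0_iff_AE) auto
  with int nn show ?thesis by simp
qed

text \<open>Hoelder's inequality with exponents \<open>1 / \<alpha>\<close> and
  \<open>1 / (1 - \<alpha>)\<close>, in a form whose proof by tangents carries over to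
  \<open>\<alpha> > 1\<close> and to the relative entropy.\<close>

lemma nn_integral_powr_le:
  fixes f g :: "'a \<Rightarrow> real"
  assumes [measurable]: "f \<in> borel_measurable N" "g \<in> borel_measurable N"
    and nn: "\<And>x. 0 \<le> f x" "\<And>x. 0 \<le> g x" "0 \<le> F" "0 \<le> G"
    and int: "(\<integral>\<^sup>+x. ennreal (f x) \<partial>N) = ennreal F" "(\<integral>\<^sup>+x. ennreal (g x) \<partial>N) = ennreal G"
    and \<alpha>: "0 < \<alpha>" "\<alpha> < 1"
  shows "(\<integral>\<^sup>+x. ennreal (f x powr \<alpha> * g x powr (1 - \<alpha>)) \<partial>N) \<le> ennreal (F powr \<alpha> * G powr (1 - \<alpha>))"
proof (cases "F = 0 \<or> G = 0")
  case True
  then have "AE x in N. f x = 0 \<or> g x = 0"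
  proof
    assume "F = 0"
    then have "AE x in N. f x = 0"
      using int nn by (intro nn_integral_ennreal_eq_0) auto
    then show ?thesis by eventually_elim auto
  next
    assume "G = 0"
    then have "AE x in N. g x = 0"
      using int nn by (intro nn_integral_ennreal_eq_0) auto
    then show ?thesis by eventually_elim auto
  qed
  then have "AE x in N. ennreal (f x powr \<alpha> * g x powr (1 - \<alpha>)) = 0"
    by eventually_elim auto
  then have "(\<integral>\<^sup>+x. ennreal (f x powr \<alpha> * g x powr (1 - \<alpha>)) \<partial>N) = 0"
    by (subst nn_integral_0_iff_AE) auto
  then show ?thesis by simp
next
  case False
  then have FG: "0 < F" "0 < G" using nn by auto
  \<comment> \<open>With this slope the tangent plane touches the function at \<open>(F, G)\<close>,
    so the integrated bound \<open>A * F + B * G\<close> is exactly the desired value.\<close>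
  define c where "c = F / G"
  have c: "0 < c" using FG by (simp add: c_def)
  define A where "A = \<alpha> * c powr (\<alpha> - 1)"
  define B where "B = (1 - \<alpha>) * c powr \<alpha>"
  have AB: "0 \<le> A" "0 \<le> B" using \<alpha> by (auto simp: A_def B_def)
  have "(\<integral>\<^sup>+x. ennreal (f x powr \<alpha> * g x powr (1 - \<alpha>)) \<partial>N) \<le>
      (\<integral>\<^sup>+x. ennreal A * ennreal (f x) + ennreal B * ennreal (g x) \<partial>N)"
    using powr_tangent_upper[OF \<alpha> _ _ c] AB nn
    by (intro nn_integral_mono)
       (simp add: A_def B_def ennreal_leI flip: ennreal_mult ennreal_plus)
  also have "\<dots> = ennreal (A * F + B * G)"
    using AB nn by (simp add: nn_integral_add nn_integral_cmult int ennreal_mult)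
  also have "A * F + B * G = F powr \<alpha> * G powr (1 - \<alpha>)"
    using FG by (simp add: A_def B_def c_def powr_divide powr_diff field_simps)
  finally show ?thesis .
qed

text \<open>The reverse inequality beyond order 1, where convexity replaces concavity. The tangent
  bound needs \<open>g x = 0 \<longrightarrow> f x = 0\<close>, hence the inequality of the
  integrands only almost everywhere.\<close>

lemma nn_integral_powr_ge:
  fixes f g :: "'a \<Rightarrow> real"
  assumes [measurable]: "f \<in> borel_measurable N" "g \<in> borel_measurable N"
    and nn: "\<And>x. 0 \<le> f x" "\<And>x. 0 \<le> g x" "0 \<le> F" "0 \<le> G"
    and int: "(\<integral>\<^sup>+x. ennreal (f x) \<partial>N) = ennreal F" "(\<integral>\<^sup>+x. ennreal (g x) \<partial>N) = ennreal G"
    and ac: "AE x in N. g x = 0 \<longrightarrow> f x = 0"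
    and \<alpha>: "1 < \<alpha>"
  shows "ennreal (F powr \<alpha> * G powr (1 - \<alpha>)) \<le> (\<integral>\<^sup>+x. ennreal (f x powr \<alpha> * g x powr (1 - \<alpha>)) \<partial>N)"
proof (cases "F = 0 \<or> G = 0")
  case False
  then have FG: "0 < F" "0 < G" using nn by auto
  define c where "c = F / G"
  have c: "0 < c" using FG by (simp add: c_def)
  define A where "A = \<alpha> * c powr (\<alpha> - 1)"
  define B where "B = (\<alpha> - 1) * c powr \<alpha>"
  have AB: "0 \<le> A" "0 \<le> B" using \<alpha> by (auto simp: A_def B_def)
  have "ennreal A * ennreal F = (\<integral>\<^sup>+x. ennreal A * ennreal (f x) \<partial>N)"
    by (simp add: nn_integral_cmult int)
  also have "\<dots> \<le> (\<integral>\<^sup>+x. ennreal (f x powr \<alpha> * g x powr (1 - \<alpha>)) + ennreal B * ennreal (g x) \<partial>N)"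
  proof (intro nn_integral_mono_AE, use ac in eventually_elim)
    case (elim x)
    show ?case
      using powr_tangent_lower[OF \<alpha> nn(1) nn(2) c elim] AB nn
      by (simp add: A_def B_def ennreal_leI flip: ennreal_mult ennreal_plus)
  qed
  also have "\<dots> = (\<integral>\<^sup>+x. ennreal (f x powr \<alpha> * g x powr (1 - \<alpha>)) \<partial>N) + ennreal (B * G)"
    using AB nn by (simp add: nn_integral_add nn_integral_cmult int ennreal_mult)
  also have "ennreal A * ennreal F = ennreal (F powr \<alpha> * G powr (1 - \<alpha>)) + ennreal (B * G)"
  proof -
    have "A * F = F powr \<alpha> * G powr (1 - \<alpha>) + B * G"
      using FG by (simp add: A_def B_def c_def powr_divide powr_diff field_simps)
    then show ?thesis
      using AB nn by (simp flip: ennreal_mult ennreal_plus)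
  qed
  \<comment> \<open>The common summand \<open>ennreal (B * G)\<close> is finite, so it cancels even
    if the integral is infinite.\<close>
  finally show ?thesis
    by (simp add: ennreal_add_left_cancel_le add.commute)
next
  case True
  then have "F = 0"
    using absolutely_continuous_mass[OF assms(1,2) nn(1-3) int ac] by auto
  then show ?thesis by simp
qed

text \<open>The integral form of the log sum inequality, \<open>F * ln (F / G)\<close> against the
  integral of \<open>f * ln (f / g)\<close>. As \<open>ennreal\<close> truncates negative reals to
  0, the four terms are positive and negative parts; placing the negative parts on the opposite
  sides avoids subtracting possibly infinite integrals.\<close>

lemma log_sum_inequality:
  fixes f g :: "'a \<Rightarrow> real"
  assumes [measurable]: "f \<in> borel_measurable N" "g \<in> borel_measurable N"
    and nn: "\<And>x. 0 \<le> f x" "\<And>x. 0 \<le> g x" "0 \<le> F" "0 \<le> G"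
    and int: "(\<integral>\<^sup>+x. ennreal (f x) \<partial>N) = ennreal F" "(\<integral>\<^sup>+x. ennreal (g x) \<partial>N) = ennreal G"
    and ac: "AE x in N. g x = 0 \<longrightarrow> f x = 0"
  shows "ennreal (F * ln (F / G)) + (\<integral>\<^sup>+x. ennreal (- (f x * ln (f x / g x))) \<partial>N) \<le>
    (\<integral>\<^sup>+x. ennreal (f x * ln (f x / g x)) \<partial>N) + ennreal (- (F * ln (F / G)))"
proof (cases "F = 0 \<or> G = 0")
  case False
  then have FG: "0 < F" "0 < G" using nn by auto
  define c where "c = F / G"
  have c: "0 < c" using FG by (simp add: c_def)
  \<comment> \<open>The tangent coefficient \<open>ln c\<close> may have either sign. Splitting it
    into \<open>P - Q\<close> lets each nonnegative part stand on the side where it is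
    added.\<close>
  define P where "P = max 0 (ln c)"
  define Q where "Q = max 0 (- ln c)"
  have PQ: "0 \<le> P" "0 \<le> Q" "P - Q = ln c" by (auto simp: P_def Q_def)
  define k where "k = (\<lambda>x. f x * ln (f x / g x))"
  have [measurable]: "k \<in> borel_measurable N" by (simp add: k_def)
  have "ennreal (P * F) + ennreal F + (\<integral>\<^sup>+x. ennreal (- k x) \<partial>N) =
      (\<integral>\<^sup>+x. ennreal P * ennreal (f x) + ennreal (f x) + ennreal (- k x) \<partial>N)"
    using PQ nn by (simp add: nn_integral_add nn_integral_cmult int ennreal_mult)
  also have "\<dots> \<le> (\<integral>\<^sup>+x. ennreal (k x) + ennreal c * ennreal (g x) + ennreal Q * ennreal (f x) \<partial>N)"
  proof (intro nn_integral_mono_AE, use ac in eventually_elim)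
    case (elim x)
    have "f x * (P - Q) + f x \<le> k x + c * g x"
      using entropy_tangent[OF nn(1) nn(2) c elim] by (simp add: k_def PQ)
    \<comment> \<open>Uses that \<open>k x\<close> is the difference of \<open>max 0 (k x)\<close>
      and \<open>max 0 (- k x)\<close>.\<close>
    then have "P * f x + f x + max 0 (- k x) \<le> max 0 (k x) + c * g x + Q * f x"
      by (simp add: algebra_simps max_def)
    then have "ennreal (P * f x + f x + max 0 (- k x)) \<le> ennreal (max 0 (k x) + c * g x + Q * f x)"
      by (rule ennreal_leI)
    moreover have "ennreal (max 0 (- k x)) = ennreal (- k x)" "ennreal (max 0 (k x)) = ennreal (k x)"
      by (auto simp: max_def ennreal_neg)
    ultimately show ?case
      using PQ nn c by (simp add: ennreal_mult ennreal_plus)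
  qed
  also have "\<dots> = (\<integral>\<^sup>+x. ennreal (k x) \<partial>N) + ennreal (c * G) + ennreal (Q * F)"
    using PQ nn c by (simp add: nn_integral_add nn_integral_cmult int ennreal_mult)
  \<comment> \<open>The tangent terms \<open>u\<close> and \<open>c * v\<close> thus integrate to
    the same finite mass \<open>F\<close>, which cancels.\<close>
  also have "c * G = F" using FG by (simp add: c_def)
  finally have "ennreal F + (ennreal (P * F) + (\<integral>\<^sup>+x. ennreal (- k x) \<partial>N)) \<le>
      ennreal F + ((\<integral>\<^sup>+x. ennreal (k x) \<partial>N) + ennreal (Q * F))"
    by (simp add: ac_simps)
  then have "ennreal (P * F) + (\<integral>\<^sup>+x. ennreal (- k x) \<partial>N) \<le> (\<integral>\<^sup>+x. ennreal (k x) \<partial>N) + ennreal (Q * F)"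
    by (simp add: ennreal_add_left_cancel_le)
  moreover have "ennreal (P * F) = ennreal (F * ln (F / G))"
    using FG by (auto simp: P_def c_def max_def ennreal_neg mult.commute mult_nonneg_nonpos)
  moreover have "ennreal (Q * F) = ennreal (- (F * ln (F / G)))"
    using FG by (auto simp: Q_def c_def max_def ennreal_neg mult.commute)
  ultimately show ?thesis by (simp add: k_def)
next
  case True
  then have "F = 0"
    using absolutely_continuous_mass[OF assms(1,2) nn(1-3) int ac] by auto
  then have "AE x in N. f x = 0"
    using int nn by (intro nn_integral_ennreal_eq_0) auto
  then have "AE x in N. ennreal (- (f x * ln (f x / g x))) = 0"
    by eventually_elim auto
  then have "(\<integral>\<^sup>+x. ennreal (- (f x * ln (f x / g x))) \<partial>N) = 0"
    by (subst nn_integral_0_iff_AE) auto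
  then show ?thesis using \<open>F = 0\<close> by simp
qed

section \<open>The change of variables from estimate to error\<close>

text \<open>The shear from \<open>(y, x)\<close> to \<open>(x + y, x)\<close> preserves Lebesgue
  measure: for each fixed \<open>x\<close> it is a translation, and Tonelli exchanges the order of
  integration.\<close>

lemma nn_integral_error_coordinates:
  fixes h :: "real \<times> real \<Rightarrow> ennreal"
  assumes [measurable]: "h \<in> borel_measurable borel"
  shows "(\<integral>\<^sup>+z. h z \<partial>lborel) = (\<integral>\<^sup>+y. \<integral>\<^sup>+x. h (x + y, x) \<partial>lborel \<partial>lborel)"
proof -
  have "(\<integral>\<^sup>+z. h z \<partial>lborel) = (\<integral>\<^sup>+x. \<integral>\<^sup>+a. h (a, x) \<partial>lborel \<partial>lborel)"
    by (subst lborel_pair.nn_integral_snd) (simp_all add: lborel_prod)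
  also have "\<dots> = (\<integral>\<^sup>+x. \<integral>\<^sup>+y. h (x + y, x) \<partial>lborel \<partial>lborel)"
  proof (rule nn_integral_cong)
    fix x :: real
    show "(\<integral>\<^sup>+a. h (a, x) \<partial>lborel) = (\<integral>\<^sup>+y. h (x + y, x) \<partial>lborel)"
      using nn_integral_real_affine[of "\<lambda>a. h (a, x)" 1 x] by simp
  qed
  also have "\<dots> = (\<integral>\<^sup>+y. \<integral>\<^sup>+x. h (x + y, x) \<partial>lborel \<partial>lborel)"
  proof (rule lborel_pair.Fubini')
    have "(\<lambda>z::real \<times> real. (snd z + fst z, snd z)) \<in> borel_measurable borel"
      by (intro borel_measurable_continuous_onI continuous_intros)
    from measurable_compose[OF this assms]
    show "(\<lambda>(y, x). h (x + y, x)) \<in> borel_measurable (lborel \<Otimes>\<^sub>M lborel)"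
      by (simp add: lborel_prod case_prod_unfold)
  qed
  finally show ?thesis .
qed

text \<open>A null set of the plane has null slices at almost every error: the change of coordinates
  is applied to the indicator of the exceptional set.\<close>

lemma AE_error_coordinates:
  fixes P :: "real \<times> real \<Rightarrow> bool"
  assumes [measurable]: "Measurable.pred borel P" and "AE z in lborel. P z"
  shows "AE y in lborel. AE x in lborel. P (x + y, x)"
proof -
  have "(\<integral>\<^sup>+z. indicator {z. \<not> P z} z \<partial>lborel) = (0 :: ennreal)"
    using assms(2) by (subst nn_integral_0_iff_AE) (auto simp: indicator_def)
  then have "(\<integral>\<^sup>+y. \<integral>\<^sup>+x. indicator {z. \<not> P z} (x + y, x) \<partial>lborel \<partial>lborel) = (0 :: ennreal)"
    by (subst (asm) nn_integral_error_coordinates) auto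
  then have "AE y in lborel. (\<integral>\<^sup>+x. indicator {z. \<not> P z} (x + y, x) \<partial>lborel) = (0 :: ennreal)"
    by (subst (asm) nn_integral_0_iff_AE) auto
  then show ?thesis
  proof eventually_elim
    case (elim y)
    then have "AE x in lborel. indicator {z. \<not> P z} (x + y, x) = (0 :: ennreal)"
      by (subst (asm) nn_integral_0_iff_AE) auto
    then show ?case by eventually_elim (auto simp: indicator_def split: if_splits)
  qed
qed

text \<open>\<open>error_density\<close> is a Bochner integral, with default value 0 where the slice
  is not integrable. The total mass 1 is finite, which confines such errors to a null set.\<close>

lemma AE_nn_integral_eq_error_density:
  assumes "prob_density f"
  shows "AE y in lborel. (\<integral>\<^sup>+x. ennreal (f (x + y, x)) \<partial>lborel) = ennreal (error_density f y)"
proof -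
  have [measurable]: "f \<in> borel_measurable borel" and nn: "\<And>z. 0 \<le> f z"
    and "(\<integral>\<^sup>+z. ennreal (f z) \<partial>lborel) = 1"
    using assms by (auto simp: prob_density_def)
  then have "(\<integral>\<^sup>+y. \<integral>\<^sup>+x. ennreal (f (x + y, x)) \<partial>lborel \<partial>lborel) \<noteq> \<infinity>"
    by (subst (asm) nn_integral_error_coordinates) auto
  then have "AE y in lborel. (\<integral>\<^sup>+x. ennreal (f (x + y, x)) \<partial>lborel) \<noteq> \<infinity>"
    by (intro nn_integral_PInf_AE) auto
  then show ?thesis
  proof eventually_elim
    case (elim y)
    then have "integrable lborel (\<lambda>x. f (x + y, x))"
      using nn by (intro integrableI_nonneg) (auto simp: top.not_eq_extremum)
    then show ?case
      using nn by (simp add: nn_integral_eq_integral error_density_def)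
  qed
qed

lemma borel_measurable_error_density [measurable]:
  assumes [measurable]: "f \<in> borel_measurable borel"
  shows "error_density f \<in> borel_measurable borel"
  unfolding error_density_def by measurable

lemma prob_density_error_density:
  assumes "prob_density f"
  shows "prob_density (error_density f)"
proof -
  have [measurable]: "f \<in> borel_measurable borel" and nn: "\<And>z. 0 \<le> f z"
    and 1: "(\<integral>\<^sup>+z. ennreal (f z) \<partial>lborel) = 1"
    using assms by (auto simp: prob_density_def)
  have "(\<integral>\<^sup>+y. ennreal (error_density f y) \<partial>lborel) =
      (\<integral>\<^sup>+y. \<integral>\<^sup>+x. ennreal (f (x + y, x)) \<partial>lborel \<partial>lborel)"
    using AE_nn_integral_eq_error_density[OF assms]
    by (intro nn_integral_cong_AE, eventually_elim) simp
  also have "\<dots> = 1"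
    using 1 by (subst (asm) nn_integral_error_coordinates) auto
  finally show ?thesis
    using nn by (auto simp: prob_density_def error_density_def[of f] intro!: integral_nonneg_AE
      borel_measurable_error_density[unfolded error_density_def])
qed

section \<open>Data processing\<close>

lemma ln_ext_mono:
  assumes "u \<le> v"
  shows "ln_ext u \<le> ln_ext v"
proof (cases "u = 0 \<or> v = \<top>")
  case False
  with assms have "u \<noteq> \<top>" "v \<noteq> 0" by (auto simp: top_unique)
  moreover from this False have "0 < enn2real u" "enn2real u \<le> enn2real v"
    using assms by (auto simp: enn2real_positive_iff less_top enn2real_mono zero_less_iff_neq_zero)
  ultimately show ?thesis using False by (simp add: ln_ext_def)
qed (auto simp: ln_ext_def)

text \<open>The tangent at \<open>c = 1\<close> bounds the negative part pointwise by
  \<open>q\<close>. Hence the difference in \<open>relative_entropy\<close> is never of the form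
  infinity minus infinity.\<close>

lemma relative_entropy_negative_part_le_1:
  assumes "prob_density p" "prob_density q" "AE z in lborel. q z = 0 \<longrightarrow> p z = 0"
  shows "(\<integral>\<^sup>+z. ennreal (- (p z * ln (p z / q z))) \<partial>lborel) \<le> 1"
proof -
  have "(\<integral>\<^sup>+z. ennreal (- (p z * ln (p z / q z))) \<partial>lborel) \<le> (\<integral>\<^sup>+z. ennreal (q z) \<partial>lborel)"
  proof (intro nn_integral_mono_AE, use assms(3) in eventually_elim)
    case (elim z)
    have "0 \<le> p z" "0 \<le> q z" using assms by (auto simp: prob_density_def)
    then show ?case
      using entropy_tangent[of "p z" "q z" 1] elim by (intro ennreal_leI) auto
  qed
  then show ?thesis using assms by (simp add: prob_density_def)
qed

text \<open>Keeps the error densities out of the infinite branch of the divergence for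
  \<open>\<alpha> \<ge> 1\<close> whenever the original densities are out of it.\<close>

lemma AE_error_density_absolutely_continuous:
  assumes f: "prob_density f" and g: "prob_density g"
    and ac: "AE z in lborel. g z = 0 \<longrightarrow> f z = 0"
  shows "AE y in lborel. error_density g y = 0 \<longrightarrow> error_density f y = 0"
proof -
  have [measurable]: "f \<in> borel_measurable borel" "g \<in> borel_measurable borel"
    and nn: "\<And>z. 0 \<le> f z" "\<And>z. 0 \<le> g z" "\<And>y. 0 \<le> error_density f y"
    using f g prob_density_error_density[OF f] by (auto simp: prob_density_def)
  have "AE y in lborel. AE x in lborel. g (x + y, x) = 0 \<longrightarrow> f (x + y, x) = 0"
    using ac by (intro AE_error_coordinates) auto
  with AE_nn_integral_eq_error_density[OF f] AE_nn_integral_eq_error_density[OF g]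
  show ?thesis
  proof eventually_elim
    case (elim y)
    then show ?case
      using absolutely_continuous_mass[of "\<lambda>x. f (x + y, x)" lborel "\<lambda>x. g (x + y, x)"] nn by auto
  qed
qed

lemma relative_entropy_error_density_le:
  assumes f: "prob_density f" and g: "prob_density g"
  shows "relative_entropy (error_density f) (error_density g) \<le> relative_entropy f g"
proof (cases "AE z in lborel. g z = 0 \<longrightarrow> f z = 0")
  case True
  define F where "F = error_density f"
  define G where "G = error_density g"
  have FG: "prob_density F" "prob_density G"
    using f g by (auto simp: F_def G_def prob_density_error_density)
  have acFG: "AE y in lborel. G y = 0 \<longrightarrow> F y = 0"
    using AE_error_density_absolutely_continuous[OF f g True] by (simp add: F_def G_def)
  have [measurable]: "f \<in> borel_measurable borel" "g \<in> borel_measurable borel"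
    "F \<in> borel_measurable borel" "G \<in> borel_measurable borel"
    and nn: "\<And>z. 0 \<le> f z" "\<And>z. 0 \<le> g z" "\<And>y. 0 \<le> F y" "\<And>y. 0 \<le> G y"
    using f g FG by (auto simp: prob_density_def)
  define k where "k = (\<lambda>z. f z * ln (f z / g z))"
  define K where "K = (\<lambda>y. F y * ln (F y / G y))"
  have [measurable]: "k \<in> borel_measurable borel" "K \<in> borel_measurable borel"
    by (simp_all add: k_def K_def)
  \<comment> \<open>Positive and negative parts are added crosswise, so that the log sum inequality
    can be integrated over the error \<open>y\<close> within \<open>ennreal\<close>.\<close>
  have "(\<integral>\<^sup>+y. ennreal (K y) \<partial>lborel) + (\<integral>\<^sup>+z. ennreal (- k z) \<partial>lborel) =
      (\<integral>\<^sup>+y. ennreal (K y) + (\<integral>\<^sup>+x. ennreal (- k (x + y, x)) \<partial>lborel) \<partial>lborel)"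
    by (subst nn_integral_add) (auto simp: nn_integral_error_coordinates[of "\<lambda>z. ennreal (- k z)"])
  also have "\<dots> \<le> (\<integral>\<^sup>+y. (\<integral>\<^sup>+x. ennreal (k (x + y, x)) \<partial>lborel) + ennreal (- K y) \<partial>lborel)"
  proof (intro nn_integral_mono_AE)
    have "AE y in lborel. AE x in lborel. g (x + y, x) = 0 \<longrightarrow> f (x + y, x) = 0"
      using True by (intro AE_error_coordinates) auto
    with AE_nn_integral_eq_error_density[OF f] AE_nn_integral_eq_error_density[OF g]
    show "AE y in lborel. ennreal (K y) + (\<integral>\<^sup>+x. ennreal (- k (x + y, x)) \<partial>lborel) \<le>
        (\<integral>\<^sup>+x. ennreal (k (x + y, x)) \<partial>lborel) + ennreal (- K y)"
    proof eventually_elim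
      case (elim y)
      then show ?case
        using nn unfolding K_def k_def F_def G_def by (intro log_sum_inequality) auto
    qed
  qed
  also have "\<dots> = (\<integral>\<^sup>+z. ennreal (k z) \<partial>lborel) + (\<integral>\<^sup>+y. ennreal (- K y) \<partial>lborel)"
    by (subst nn_integral_add) (auto simp: nn_integral_error_coordinates[of "\<lambda>z. ennreal (k z)"])
  finally have main: "(\<integral>\<^sup>+y. ennreal (K y) \<partial>lborel) + (\<integral>\<^sup>+z. ennreal (- k z) \<partial>lborel) \<le>
      (\<integral>\<^sup>+z. ennreal (k z) \<partial>lborel) + (\<integral>\<^sup>+y. ennreal (- K y) \<partial>lborel)" .
  have "(\<integral>\<^sup>+z. ennreal (- k z) \<partial>lborel) \<le> 1" "(\<integral>\<^sup>+y. ennreal (- K y) \<partial>lborel) \<le> 1"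
    using relative_entropy_negative_part_le_1[OF f g True]
      relative_entropy_negative_part_le_1[OF FG acFG] by (simp_all add: k_def K_def)
  \<comment> \<open>The crosswise sums become differences of extended reals. This is sound because
    the subtrahends are finite; the minuends may be infinite.\<close>
  moreover have "enn2ereal A - enn2ereal B \<le> enn2ereal a - enn2ereal b"
    if "A + b \<le> a + B" "b \<le> 1" "B \<le> 1" for A B a b
    using that
    by (cases A; cases B; cases a; cases b)
       (auto simp: top_unique enn2ereal_ennreal simp flip: ennreal_plus)
  ultimately show ?thesis
    using main True acFG
    by (simp add: relative_entropy_def k_def K_def F_def G_def)
qed (simp add: relative_entropy_def)

text \<open>Data processing for the passage to the error. The inequality between the integrals
  reverses at \<open>\<alpha> = 1\<close>, and so does the sign of
  \<open>1 / (\<alpha> - 1)\<close>, so the divergence does not increase on either side.\<close>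

lemma renyi_divergence_error_density_le:
  assumes f: "prob_density f" and g: "prob_density g" and \<alpha>: "0 < \<alpha>"
  shows "renyi_divergence \<alpha> (error_density f) (error_density g) \<le> renyi_divergence \<alpha> f g"
proof -
  have [measurable]: "f \<in> borel_measurable borel" "g \<in> borel_measurable borel"
    and nn: "\<And>z. 0 \<le> f z" "\<And>z. 0 \<le> g z" "\<And>y. 0 \<le> error_density f y" "\<And>y. 0 \<le> error_density g y"
    using f g f[THEN prob_density_error_density] g[THEN prob_density_error_density]
    by (auto simp: prob_density_def)
  let ?L = "\<integral>\<^sup>+y. ennreal (error_density f y powr \<alpha> * error_density g y powr (1 - \<alpha>)) \<partial>lborel"
  let ?R = "\<integral>\<^sup>+z. ennreal (f z powr \<alpha> * g z powr (1 - \<alpha>)) \<partial>lborel"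
  have R: "?R = (\<integral>\<^sup>+y. \<integral>\<^sup>+x. ennreal (f (x + y, x) powr \<alpha> * g (x + y, x) powr (1 - \<alpha>)) \<partial>lborel \<partial>lborel)"
    by (rule nn_integral_error_coordinates) simp
  consider "\<alpha> = 1" | "\<alpha> < 1" | "1 < \<alpha>" "\<not> (AE z in lborel. g z = 0 \<longrightarrow> f z = 0)"
    | "1 < \<alpha>" "AE z in lborel. g z = 0 \<longrightarrow> f z = 0"
    by linarith
  then show ?thesis
  proof cases
    case 1
    then show ?thesis
      using relative_entropy_error_density_le[OF f g] by (simp add: renyi_divergence_def)
  next
    case 2
    have "?R \<le> ?L"
      unfolding R
    proof (intro nn_integral_mono_AE)
      from AE_nn_integral_eq_error_density[OF f] AE_nn_integral_eq_error_density[OF g]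
      show "AE y in lborel. (\<integral>\<^sup>+x. ennreal (f (x + y, x) powr \<alpha> * g (x + y, x) powr (1 - \<alpha>)) \<partial>lborel)
          \<le> ennreal (error_density f y powr \<alpha> * error_density g y powr (1 - \<alpha>))"
      proof eventually_elim
        case (elim y)
        then show ?case
          using nn \<alpha> 2 by (intro nn_integral_powr_le) auto
      qed
    qed
    \<comment> \<open>Monotonicity is applied with the positive factor
      \<open>1 / (1 - \<alpha>)\<close>; the negation that follows reverses the order, also at
      infinite values of \<open>ln_ext\<close>.\<close>
    then have "ereal (1 / (1 - \<alpha>)) * ln_ext ?R \<le> ereal (1 / (1 - \<alpha>)) * ln_ext ?L"
      using 2 by (intro ereal_mult_left_mono ln_ext_mono) auto
    moreover have "ereal (1 / (\<alpha> - 1)) = - ereal (1 / (1 - \<alpha>))"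
      by (simp add: minus_divide_right)
    ultimately show ?thesis
      using 2 by (simp add: renyi_divergence_def del: uminus_ereal.simps)
  next
    case 3
    then show ?thesis by (simp add: renyi_divergence_def)
  next
    case 4
    have "?L \<le> ?R"
      unfolding R
    proof (intro nn_integral_mono_AE)
      have "AE y in lborel. AE x in lborel. g (x + y, x) = 0 \<longrightarrow> f (x + y, x) = 0"
        using 4 by (intro AE_error_coordinates) auto
      with AE_nn_integral_eq_error_density[OF f] AE_nn_integral_eq_error_density[OF g]
      show "AE y in lborel. ennreal (error_density f y powr \<alpha> * error_density g y powr (1 - \<alpha>))
          \<le> (\<integral>\<^sup>+x. ennreal (f (x + y, x) powr \<alpha> * g (x + y, x) powr (1 - \<alpha>)) \<partial>lborel)"
      proof eventually_elim
        case (elim y)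
        then show ?case
          using nn 4 by (intro nn_integral_powr_ge) auto
      qed
    qed
    then have "ereal (1 / (\<alpha> - 1)) * ln_ext ?L \<le> ereal (1 / (\<alpha> - 1)) * ln_ext ?R"
      using 4 by (intro ereal_mult_left_mono ln_ext_mono) auto
    then show ?thesis
      using 4 AE_error_density_absolutely_continuous[OF f g 4(2)]
      by (simp add: renyi_divergence_def)
  qed
qed

section \<open>The joint density and the product density\<close>

text \<open>Serves both the joint density and the product of \<open>q\<close> and \<open>p\<close>,
  which share the parameter marginal \<open>p\<close>.\<close>

lemma prob_density_pairI:
  fixes f :: "real \<times> real \<Rightarrow> real"
  assumes [measurable]: "f \<in> borel_measurable borel" and "\<And>z. 0 \<le> f z" and p: "prob_density p"
    and "\<And>x. (\<integral>\<^sup>+a. ennreal (f (a, x)) \<partial>lborel) = ennreal (p x)"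
  shows "prob_density f"
proof -
  have "(\<integral>\<^sup>+z. ennreal (f z) \<partial>lborel) = (\<integral>\<^sup>+x. \<integral>\<^sup>+a. ennreal (f (a, x)) \<partial>lborel \<partial>lborel)"
    by (subst lborel_pair.nn_integral_snd) (simp_all add: lborel_prod)
  also have "\<dots> = 1" using assms by (simp add: prob_density_def)
  finally show ?thesis using assms by (simp add: prob_density_def)
qed

text \<open>The outcome set \<open>UNIV\<close> reduces the trace formula to the trace of
  \<open>\<rho> x\<close> itself, as \<open>M UNIV = id\<close>. Here the quantum description yields
  a classical conditional density; the rest is classical.\<close>

lemma outcome_density_normalized:
  assumes "density_operator (\<rho> x)" "povm M" "outcome_density \<rho> M t"
  shows "(\<integral>\<^sup>+a. ennreal (t a x) \<partial>lborel) = 1"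
proof -
  have "\<forall>A\<in>sets borel.
      (\<integral>\<^sup>+a\<in>A. ennreal (t a x) \<partial>lborel) = ennreal (Re (op_trace (\<rho> x \<circ> M A)))"
    using assms(3) by (simp add: outcome_density_def)
  from bspec[OF this, of UNIV] show ?thesis
    using assms(1,2) by (simp add: povm_def density_operator_def)
qed

text \<open>\<open>error_density\<close> integrates over the parameter and \<open>conv\<close> over
  the estimate. Translation by \<open>y\<close> passes from one to the other, and the reflection of
  \<open>p\<close> turns \<open>y - x\<close> into \<open>x - y\<close>.\<close>

lemma error_density_product:
  "error_density (\<lambda>(a, x). q a * p x) = conv q (\<lambda>x. p (- x))"
proof
  fix y :: real
  have "(\<integral>x. q x * p (- (y - x)) \<partial>lborel) = (\<integral>x. q (y + 1 * x) * p (- (y - (y + 1 * x))) \<partial>lborel)"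
    by (subst lborel_integral_real_affine[where c = 1 and t = y]) auto
  then show "error_density (\<lambda>(a, x). q a * p x) y = conv q (\<lambda>x. p (- x)) y"
    by (simp add: error_density_def conv_def add.commute)
qed

theorem theorem4:
  fixes \<rho> :: "real \<Rightarrow> 'h::chilbert_space \<Rightarrow> 'h"
    and p :: "real \<Rightarrow> real"
    and M :: "real set \<Rightarrow> 'h \<Rightarrow> 'h"
    and t :: "real \<Rightarrow> real \<Rightarrow> real"
    and \<alpha> :: real
  assumes "\<And>x. density_operator (\<rho> x)"
    and "prob_density p"
    and "povm M"
    and "outcome_density \<rho> M t"
    and "1 / 2 \<le> \<alpha>"
  shows "renyi_mutual_information \<alpha> (joint_density p t) \<ge>
    (INF q\<in>{q. prob_density q}.
       renyi_divergence \<alpha> (error_density (joint_density p t)) (conv q (\<lambda>x. p (- x))))"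
proof -
  have [measurable]: "p \<in> borel_measurable borel" "(\<lambda>(a, x). t a x) \<in> borel_measurable borel"
    and nn: "\<And>x. 0 \<le> p x" "\<And>a x. 0 \<le> t a x"
    using assms(2,4) by (auto simp: prob_density_def outcome_density_def)
  have "(\<lambda>a. (\<lambda>(a, x). t a x) (a, x)) \<in> borel_measurable borel" for x
    by (rule measurable_compose[of "\<lambda>a. (a, x)" borel borel]) (auto intro: borel_measurable_Pair)
  then have [measurable]: "(\<lambda>a. t a x) \<in> borel_measurable borel" for x
    by simp
  have t1: "(\<integral>\<^sup>+a. ennreal (t a x) \<partial>lborel) = 1" for x
    using assms by (intro outcome_density_normalized)
  have joint_eq: "joint_density p t = (\<lambda>z. p (snd z) * (\<lambda>(a, x). t a x) z)"
    by (auto simp: joint_density_def)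
  \<comment> \<open>Recorded for the later calls of \<open>fact\<close>: the projections are
    measurable on the Borel sets of the plane because they are continuous.\<close>
  have "fst \<in> borel_measurable (borel :: (real \<times> real) measure)"
    and "snd \<in> borel_measurable (borel :: (real \<times> real) measure)"
    by (intro borel_measurable_continuous_onI continuous_intros)+
  have joint: "prob_density (joint_density p t)"
  proof (rule prob_density_pairI[OF _ _ assms(2)])
    show "joint_density p t \<in> borel_measurable borel" 
      unfolding joint_eq
      by (intro borel_measurable_times measurable_compose[of snd borel borel p]) fact+
  next
    fix x
    show "(\<integral>\<^sup>+a. ennreal (joint_density p t (a, x)) \<partial>lborel) = ennreal (p x)"
      using nn by (simp add: joint_density_def ennreal_mult nn_integral_cmult t1)
  qed (use nn in \<open>auto simp: joint_density_def\<close>)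
  \<comment> \<open>The equality holds at every \<open>x\<close>, since \<open>t\<close> is
    normalised for every parameter, so \<open>p\<close> can be substituted inside the mutual
    information.\<close>
  have marginal: "snd_marginal (joint_density p t) = p"
  proof
    fix x
    have "(\<integral>a. t a x \<partial>lborel) = 1"
      using nn t1 by (subst integral_eq_nn_integral) auto
    then show "snd_marginal (joint_density p t) x = p x"
      by (simp add: snd_marginal_def joint_density_def)
  qed
  show ?thesis
    unfolding renyi_mutual_information_def marginal
  proof (rule INF_mono)
    fix q :: "real \<Rightarrow> real"
    assume "q \<in> {q. prob_density q}"
    then have q: "prob_density q" by simp
    then have [measurable]: "q \<in> borel_measurable borel" and nnq: "\<And>x. 0 \<le> q x"
      by (auto simp: prob_density_def)
    have "prob_density (\<lambda>(a, x). q a * p x)"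
    proof (rule prob_density_pairI[OF _ _ assms(2)])
      show "(\<lambda>(a, x). q a * p x) \<in> borel_measurable borel"
        unfolding case_prod_unfold
        by (intro borel_measurable_times measurable_compose[of fst borel borel q]
            measurable_compose[of snd borel borel p]) fact+
    next
      fix x
      show "(\<integral>\<^sup>+a. ennreal (case (a, x) of (a, x) \<Rightarrow> q a * p x) \<partial>lborel) = ennreal (p x)"
        using nn nnq q by (simp add: ennreal_mult nn_integral_multc prob_density_def)
    qed (use nn nnq in \<open>auto simp: case_prod_unfold\<close>)
    then have "renyi_divergence \<alpha> (error_density (joint_density p t)) (conv q (\<lambda>x. p (- x))) \<le>
        renyi_divergence \<alpha> (joint_density p t) (\<lambda>(a, x). q a * p x)"
      using renyi_divergence_error_density_le[OF joint, of _ \<alpha>] assms(5)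
      by (simp flip: error_density_product)
    with q show "\<exists>r\<in>{q. prob_density q}.
        renyi_divergence \<alpha> (error_density (joint_density p t)) (conv r (\<lambda>x. p (- x))) \<le>
        renyi_divergence \<alpha> (joint_density p t) (\<lambda>(a, x). q a * p x)"
      by blast
  qed
qed

end
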